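(* Let $m,n\geq 3$ and $(m-1)(n-1)+1\leq p\leq mn$ be integers. (1) If there exists a nonsingular bilinear map $\mathbb{R}^m\times\mathbb{R}^n\to\mathbb{R}^{mn-p}$, then $\mathbb{R}^{m\times n\times p}$ has plural typical ranks. (2) If $p\geq (m-1)(n-1)+2$ and $\mathbb{R}^{m\times n\times p}$ has plural typical ranks, then there exists a nonsingular bilinear map $\mathbb{R}^m\times\mathbb{R}^n\to\mathbb{R}^{mn-p}$.
   Context: $\mathbb{R}^{m\times n\times p}$ is the space of real $m\times n\times p$ tensors (3-way arrays, i.e. elements of $\mathbb{R}^m\otimes\mathbb{R}^n\otimes\mathbb{R}^p$) with the Euclidean topology. The rank of a tensor $T$ is the minimal $r$ such that $T=\sum_{i=1}^r \mathbf{a}_i\otimes\mathbf{b}_i\otimes\mathbf{c}_i$ with $\mathbf{a}_i\in\mathbb{R}^m$, $\mathbf{b}_i\in\mathbb{R}^n$, $\mathbf{c}_i\in\mathbb{R}^p$. An integer $r$ is a typical rank of $\mathbb{R}^{m\times n\times p}$ if the set of tensors of rank $r$ contains a nonempty open subset of $\mathbb{R}^{m\times n\times p}$. "Plural typical ranks" means at least two distinct typical ranks. A bilinear map $f\colon\mathbb{R}^m\times\mathbb{R}^n\to\mathbb{R}^l$ is nonsingular if $f(\mathbf{x},\mathbf{y})=0$ implies $\mathbf{x}=0$ or $\mathbf{y}=0$. *)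

theory Defs
  imports "HOL-Analysis.Analysis"
begin

text \<open>The space of real \<open>m \<times> n \<times> p\<close> tensors is \<^typ>\<open>real ^ 'p ^ 'n ^ 'm\<close> with its Euclidean
  topology, where \<open>m = CARD('m)\<close>, \<open>n = CARD('n)\<close>, \<open>p = CARD('p)\<close>; the entry at position
  \<open>(i, j, k)\<close> of \<open>T\<close> is \<open>T $ i $ j $ k\<close>.\<close>

definition tensor3 :: "real ^ 'm \<Rightarrow> real ^ 'n \<Rightarrow> real ^ 'p \<Rightarrow> real ^ 'p ^ 'n ^ 'm" where
  "tensor3 a b c = (\<chi> i j k. a $ i * b $ j * c $ k)"

definition sum_of_rank_ones :: "nat \<Rightarrow> real ^ 'p ^ 'n ^ 'm \<Rightarrow> bool" where
  "sum_of_rank_ones r T \<longleftrightarrow>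
     (\<exists>(a :: nat \<Rightarrow> real ^ 'm) (b :: nat \<Rightarrow> real ^ 'n) (c :: nat \<Rightarrow> real ^ 'p).
        T = (\<Sum>i<r. tensor3 (a i) (b i) (c i)))"

definition tensor_rank :: "real ^ 'p ^ 'n ^ 'm \<Rightarrow> nat" where
  "tensor_rank T = (LEAST r. sum_of_rank_ones r T)"

text \<open>The minimum in the definition of the rank is always attained.\<close>

lemma ex_sum_of_rank_ones: "\<exists>r. sum_of_rank_ones r (T :: real ^ 'p ^ 'n ^ 'm)"
proof -
  let ?I = "UNIV :: ('m \<times> 'n \<times> 'p) set"
  let ?f = "\<lambda>(i, j, k). tensor3 (axis i (T $ i $ j $ k)) (axis j 1) (axis k 1)"
  obtain h where h: "bij_betw h {..<card ?I} ?I"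
    using ex_bij_betw_nat_finite[of ?I] by (auto simp: atLeast0LessThan)
  have "(\<Sum>x\<in>?I. ?f x) $ i $ j $ k = T $ i $ j $ k" for i j k
  proof -
    have "?f x $ i $ j $ k = (if x = (i, j, k) then T $ i $ j $ k else 0)" for x
      by (cases x) (auto simp: tensor3_def axis_def)
    then have "(\<Sum>x\<in>?I. ?f x) $ i $ j $ k = (\<Sum>x\<in>?I. if x = (i, j, k) then T $ i $ j $ k else 0)"
      by (simp only: sum_component)
    then show ?thesis by simp
  qed
  then have "T = (\<Sum>x\<in>?I. ?f x)"
    by (simp add: vec_eq_iff)
  also have "\<dots> = (\<Sum>l<card ?I. ?f (h l))"
    by (rule sum.reindex_bij_betw[OF h, symmetric])
  finally have "T = (\<Sum>l<card ?I. tensor3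
      ((\<lambda>(i, j, k). axis i (T $ i $ j $ k)) (h l)) ((\<lambda>(i, j, k). axis j 1) (h l))
      ((\<lambda>(i, j, k). axis k 1) (h l)))"
    by (simp only: case_prod_beta)
  then have "sum_of_rank_ones (card ?I) T"
    unfolding sum_of_rank_ones_def by (intro exI)
  then show ?thesis ..
qed

definition typical_rank :: "(real ^ 'p ^ 'n ^ 'm) itself \<Rightarrow> nat \<Rightarrow> bool" where
  "typical_rank _ r \<longleftrightarrow>
     (\<exists>U :: (real ^ 'p ^ 'n ^ 'm) set. open U \<and> U \<noteq> {} \<and> U \<subseteq> {T. tensor_rank T = r})"

definition plural_typical_ranks :: "(real ^ 'p ^ 'n ^ 'm) itself \<Rightarrow> bool" where
  "plural_typical_ranks S \<longleftrightarrow> (\<exists>r s. r \<noteq> s \<and> typical_rank S r \<and> typical_rank S s)"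

text \<open>The target dimension \<open>l\<close> below will be \<open>m * n - p\<close>, which may be \<open>0\<close>, so that \<open>\<real>\<^sup>l\<close> cannot be
  a type \<open>real ^ 'l\<close>. It is the carrier of the library's \<open>Euclidean_space l\<close>, i.e. the set of all
  \<open>v :: nat \<Rightarrow> real\<close> with \<open>v i = 0\<close> for \<open>i \<ge> l\<close>. As there is no vector space instance for
  \<open>nat \<Rightarrow> real\<close>, bilinearity is stated coordinatewise.\<close>

definition nonsingular_bilinear_map :: "nat \<Rightarrow> (real ^ 'm \<Rightarrow> real ^ 'n \<Rightarrow> nat \<Rightarrow> real) \<Rightarrow> bool" where
  "nonsingular_bilinear_map l f \<longleftrightarrow>
     (\<forall>x y. f x y \<in> topspace (Euclidean_space l)) \<and>
     (\<forall>i. bilinear (\<lambda>x y. f x y i)) \<and>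
     (\<forall>x y. f x y = (\<lambda>_. 0) \<longrightarrow> x = 0 \<or> y = 0)"

end

theory Submission
  imports Defs
begin

text \<open>
  Regard a tensor \<open>T\<close> as the list of its \<open>p\<close> slices, which are \<open>m \<times> n\<close> matrices. It is a sum of \<open>r\<close> rank-one
  tensors precisely when the slices lie in the span of \<open>r\<close> matrices of the form \<open>x \<otimes> y\<close>. As \<open>p \<le> m n\<close>, the
  slices are linearly independent on a dense set of tensors, so no typical rank is smaller than \<open>p\<close>.

  Since \<open>p \<ge> (m - 1) (n - 1) + 1\<close>, for generic \<open>a\<^sub>i\<close> and \<open>b\<^sub>i\<close> the tangent space of the cone of rank-one
  matrices at any one of the \<open>p\<close> matrices \<open>a\<^sub>i \<otimes> b\<^sub>i\<close> spans, together with the other \<open>p - 1\<close> of them, the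
  space of all matrices (\<open>generic_tangent_sum\<close>). Hence the map sending \<open>(a, b, c)\<close> to
  \<open>\<Sum>i. a\<^sub>i \<otimes> b\<^sub>i \<otimes> c\<^sub>i\<close> is a submersion at generic points. It follows that \<open>p\<close> is a typical rank, and that for
  \<open>r \<ge> p\<close> every sum of \<open>r\<close> rank-one tensors is a limit of interior points of the set of such sums
  (\<open>sum_of_rank_ones_near_interior\<close>).

  (1) A nonsingular bilinear map to \<open>\<real>\<^sup>m\<^sup>n\<^sup>-\<^sup>p\<close> gives a space of matrices, of dimension at least \<open>p\<close>, without
  matrices of rank one. A tensor whose slices are independent elements of that space has rank greater than \<open>p\<close>, and
  so have all tensors near it, by compactness of the sphere of coefficients. The smallest rank on this neighbourhood
  is typical and greater than \<open>p\<close>.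

  (2) Let \<open>U\<close> be an open set of tensors of rank \<open>r > p\<close>, and suppose that there is no nonsingular bilinear map
  to \<open>\<real>\<^sup>m\<^sup>n\<^sup>-\<^sup>p\<close>. By duality, the span of the slices of any tensor with independent slices contains a
  rank-one matrix. From there, one works up to a tensor in \<open>U\<close> whose slices lie in the span of \<open>p\<close> rank-one
  matrices, which is a contradiction. The step from \<open>k\<close> to \<open>k + 1\<close> rank-one matrices among \<open>p\<close> spanning ones is
  \<open>rank_one_exchange\<close>: after a small move, transversality at one of the rank-one matrices, already achieved
  without the matrix \<open>w\<close> to be replaced because \<open>p - 1 \<ge> (m - 1) (n - 1) + 1\<close>, allows the open mapping
  theorem to produce a new rank-one matrix in the span with a nonzero coefficient at \<open>w\<close>.
\<close>

section \<open>Generic conditions\<close>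

text \<open>A line through a point of the complement of a proper algebraic set meets that set in finitely
many points. This consequence of being Zariski open and nonempty is taken as the definition: it passes to
finite conjunctions and gives density.\<close>

definition generic :: "('a::real_vector \<Rightarrow> bool) \<Rightarrow> bool" where
  "generic G \<longleftrightarrow> (\<exists>x. G x) \<and> (\<forall>x y. G y \<longrightarrow> finite {t::real. \<not> G (x + t *\<^sub>R (y - x))})"

lemma generic_True: "generic (\<lambda>_. True)"
  by (simp add: generic_def)

text \<open>Both conditions hold at all but finitely many points of the line that joins a point satisfying
the one to a point satisfying the other.\<close>

lemma generic_conj:
  fixes G H :: "'a::real_vector \<Rightarrow> bool"
  assumes G: "generic G" and H: "generic H"
  shows "generic (\<lambda>x. G x \<and> H x)"
proof -
  obtain x y where x: "G x" and y: "H y"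
    using G H by (auto simp: generic_def)
  have "finite {t::real. \<not> H (x + t *\<^sub>R (y - x))}"
    using H y by (auto simp: generic_def)
  moreover have "finite {t::real. \<not> G (x + t *\<^sub>R (y - x))}"
  proof -
    \<comment> \<open>The line is run backwards, since genericity of \<open>G\<close> is about lines towards a point satisfying \<open>G\<close>.\<close>
    have "finite {t::real. \<not> G (y + t *\<^sub>R (x - y))}"
      using G x by (auto simp: generic_def)
    moreover have "{t. \<not> G (x + t *\<^sub>R (y - x))}
        \<subseteq> (\<lambda>s. 1 - s) ` {t. \<not> G (y + t *\<^sub>R (x - y))}"
    proof
      fix t assume t: "t \<in> {t. \<not> G (x + t *\<^sub>R (y - x))}"
      have "y + (1 - t) *\<^sub>R (x - y) = x + t *\<^sub>R (y - x)"
        by (simp add: algebra_simps)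
      with t have "1 - t \<in> {t. \<not> G (y + t *\<^sub>R (x - y))}" by simp
      then show "t \<in> (\<lambda>s. 1 - s) ` {t. \<not> G (y + t *\<^sub>R (x - y))}"
        by (intro image_eqI[of _ _ "1 - t"]) auto
    qed
    ultimately show ?thesis
      by (meson finite_imageI finite_subset)
  qed
  ultimately have "finite ({t::real. \<not> G (x + t *\<^sub>R (y - x))} \<union> {t. \<not> H (x + t *\<^sub>R (y - x))})"
    by simp
  then obtain t where "t \<notin> {t::real. \<not> G (x + t *\<^sub>R (y - x))} \<union> {t. \<not> H (x + t *\<^sub>R (y - x))}"
    using ex_new_if_finite[OF infinite_UNIV_char_0] by blast
  then have "\<exists>x. G x \<and> H x" by blast
  moreover have "finite {t::real. \<not> (G (x + t *\<^sub>R (y - x)) \<and> H (x + t *\<^sub>R (y - x)))}"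
    if "G y \<and> H y" for x y
  proof -
    have "{t::real. \<not> (G (x + t *\<^sub>R (y - x)) \<and> H (x + t *\<^sub>R (y - x)))}
       = {t. \<not> G (x + t *\<^sub>R (y - x))} \<union> {t. \<not> H (x + t *\<^sub>R (y - x))}" by auto
    then show ?thesis using G H that by (simp add: generic_def)
  qed
  ultimately show ?thesis
    by (auto simp: generic_def)
qed

lemma generic_Ball:
  assumes "finite I" and "\<And>i. i \<in> I \<Longrightarrow> generic (G i)"
  shows "generic (\<lambda>x. \<forall>i\<in>I. G i x)"
  using assms
proof (induction I)
  case empty
  then show ?case by (simp add: generic_True)
next
  case (insert i I)
  have "generic (\<lambda>x. G i x \<and> (\<forall>i\<in>I. G i x))"
    using insert by (intro generic_conj) auto
  then show ?case by simp
qed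

text \<open>The parameters \<open>t\<close> with \<open>x + t (y - x)\<close> in \<open>U\<close> form an open set containing \<open>0\<close>, hence an infinite one.\<close>

lemma generic_dense:
  fixes G :: "'a::real_normed_vector \<Rightarrow> bool"
  assumes G: "generic G" and U: "open U" "x \<in> U"
  obtains x' where "G x'" "x' \<in> U"
proof -
  obtain y where "G y" using G by (auto simp: generic_def)
  let ?l = "\<lambda>t::real. x + t *\<^sub>R (y - x)"
  have fin: "finite {t. \<not> G (?l t)}"
    using G \<open>G y\<close> by (auto simp: generic_def)
  have "open (?l -` U)"
    using U by (intro open_vimage) (auto intro!: continuous_intros)
  moreover have "0 \<in> ?l -` U" using U by simp
  ultimately have "infinite (?l -` U)"
    by (metis empty_iff finite_imp_not_open)
  then have "\<not> ?l -` U \<subseteq> {t. \<not> G (?l t)}"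
    using fin finite_subset by blast
  then show ?thesis using that by blast
qed

lemma finite_roots_polynomial_function:
  fixes f :: "real \<Rightarrow> real"
  assumes f: "real_polynomial_function f" and c: "f c \<noteq> 0"
  shows "finite {t. f t = 0}"
proof -
  obtain a n where f: "f = (\<lambda>x. \<Sum>i\<le>n. a i * x ^ i)"
    using real_polynomial_function_imp_sum[OF f] by blast
  have "\<exists>i\<le>n. a i \<noteq> 0"
  proof (rule ccontr)
    assume "\<not> (\<exists>i\<le>n. a i \<noteq> 0)"
    then have "f c = 0" by (simp add: f)
    with c show False by simp
  qed
  then show ?thesis
    using polyfun_finite_roots[of a n] by (simp add: f)
qed

text \<open>If \<open>B\<close> is a right inverse of \<open>L y\<close>, then \<open>det (L z \<circ> B)\<close> is a polynomial in \<open>z\<close> that is \<open>1\<close> at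
\<open>z = y\<close>, and \<open>L z\<close> is surjective wherever it does not vanish.\<close>

lemma generic_surj_vec:
  fixes L :: "'z::euclidean_space \<Rightarrow> 'e::euclidean_space \<Rightarrow> real ^ 'k"
  assumes lin: "\<And>z. linear (L z)"
    and poly: "\<And>v. polynomial_function (\<lambda>z. L z v)"
    and ex: "\<exists>z. surj (L z)"
  shows "generic (\<lambda>z. surj (L z))"
  unfolding generic_def
proof (intro conjI ex allI impI)
  fix x y assume y: "surj (L y)"
  obtain B where B: "linear B" "L y \<circ> B = id"
    using linear_surjective_right_inverse[OF lin y] by blast
  let ?l = "\<lambda>t::real. x + t *\<^sub>R (y - x)"
  define g where "g t = det (matrix (L (?l t) \<circ> B))" for t
  have l: "polynomial_function ?l"
    by (intro polynomial_function_add polynomial_function_mult) auto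
  have "real_polynomial_function (\<lambda>t. (L (?l t) \<circ> B) v $ i)" for v i
  proof -
    have "polynomial_function (\<lambda>t. L (?l t) (B v))"
      using polynomial_function_compose[OF l poly] by (simp add: o_def)
    then have "real_polynomial_function ((\<lambda>w. w $ i) \<circ> (\<lambda>t. L (?l t) (B v)))"
      unfolding polynomial_function_def by (blast intro: bounded_linear_vec_nth)
    then show ?thesis by (simp add: o_def)
  qed
  then have "real_polynomial_function g"
    unfolding g_def det_def matrix_def
    by (intro real_polynomial_function_sum real_polynomial_function.intros(2,4)
          real_polynomial_function_prod finite_permutations) auto
  moreover have "g 1 \<noteq> 0"
    using B by (simp add: g_def matrix_id_mat_1)
  ultimately have "finite {t. g t = 0}"
    by (rule finite_roots_polynomial_function)
  moreover have "surj (L (?l t))" if "g t \<noteq> 0" for t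
  proof -
    have "linear (L (?l t) \<circ> B)"
      using lin B(1) by (simp add: linear_compose)
    then have M: "L (?l t) \<circ> B = (*v) (matrix (L (?l t) \<circ> B))"
      by (simp add: fun_eq_iff)
    have "surj ((*v) (matrix (L (?l t) \<circ> B)))"
      using that unfolding g_def
      by (simp add: invertible_det_nz[symmetric] invertible_right_inverse matrix_right_invertible_surjective)
    then have "surj (L (?l t) \<circ> B)"
      using M by metis
    then show ?thesis
      by (simp add: surj_def) blast
  qed
  ultimately show "finite {t. \<not> surj (L (?l t))}"
    by (elim rev_finite_subset) auto
qed

section \<open>Transversality to the cone of rank-one matrices\<close>

text \<open>For a vector \<open>v\<close> this is the matrix \<open>a \<otimes> v\<close>; letting \<open>v\<close> range over an arbitrary vector space makes
it iterate to the rank-one tensor \<open>a \<otimes> b \<otimes> c\<close>, so that all the calculus comes from one bilinear map.\<close>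

definition outer :: "real ^ 'm \<Rightarrow> 'v::real_vector \<Rightarrow> 'v ^ 'm" where
  "outer a v = (\<chi> i. a $ i *\<^sub>R v)"

lemma outer_nth [simp]: "outer a v $ i = a $ i *\<^sub>R v"
  by (simp add: outer_def)

lemma bounded_bilinear_outer:
  "bounded_bilinear (outer :: real ^ 'm \<Rightarrow> 'v::euclidean_space \<Rightarrow> 'v ^ 'm)"
  unfolding bilinear_conv_bounded_bilinear[symmetric] bilinear_def
  by (auto intro!: linearI simp: vec_eq_iff algebra_simps)

lemmas outer_add_left = bounded_bilinear.add_left[OF bounded_bilinear_outer]
  and outer_add_right = bounded_bilinear.add_right[OF bounded_bilinear_outer]
  and outer_scaleR_left = bounded_bilinear.scaleR_left[OF bounded_bilinear_outer]
  and outer_scaleR_right = bounded_bilinear.scaleR_right[OF bounded_bilinear_outer]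
  and outer_zero_left [simp] = bounded_bilinear.zero_left[OF bounded_bilinear_outer]
  and outer_zero_right [simp] = bounded_bilinear.zero_right[OF bounded_bilinear_outer]
  and has_derivative_outer [derivative_intros] = bounded_bilinear.FDERIV[OF bounded_bilinear_outer]
  and continuous_on_outer [continuous_intros] = bounded_bilinear.continuous_on[OF bounded_bilinear_outer]

lemma tensor3_eq_outer: "tensor3 a b c = outer a (outer b c)"
  by (simp add: vec_eq_iff tensor3_def)

lemma polynomial_function_outer:
  fixes f :: "'z::euclidean_space \<Rightarrow> real ^ 'm" and g :: "'z \<Rightarrow> 'v::euclidean_space"
  assumes f: "polynomial_function f" and g: "polynomial_function g"
  shows "polynomial_function (\<lambda>z. outer (f z) (g z))"
  unfolding polynomial_function_iff_Basis_inner
proof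
  fix u :: "'v ^ 'm" assume "u \<in> Basis"
  then obtain i v where u: "u = axis i v" "v \<in> Basis"
    by (auto simp: Basis_vec_def)
  have "real_polynomial_function ((\<lambda>w. w $ i) \<circ> f)" "real_polynomial_function ((\<lambda>w. w \<bullet> v) \<circ> g)"
    using f g unfolding polynomial_function_def
    by (blast intro: bounded_linear_vec_nth bounded_linear_inner_left)+
  then have "real_polynomial_function (\<lambda>z. f z $ i * (g z \<bullet> v))"
    unfolding o_def by (rule real_polynomial_function.intros(4))
  then show "real_polynomial_function (\<lambda>z. outer (f z) (g z) \<bullet> u)"
    by (simp add: u inner_axis)
qed

text \<open>Flattening matrices to vectors turns \<open>L z \<circ> B\<close> into an endomorphism that has a determinant.\<close>

lemma generic_surj_mat:
  fixes L :: "'z::euclidean_space \<Rightarrow> 'e::euclidean_space \<Rightarrow> real ^ 'n ^ 'm"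
  assumes lin: "\<And>z. linear (L z)"
    and poly: "\<And>v. polynomial_function (\<lambda>z. L z v)"
    and ex: "\<exists>z. surj (L z)"
  shows "generic (\<lambda>z. surj (L z))"
proof -
  let ?h = "\<lambda>M :: real ^ 'n ^ 'm. (\<chi> ij. M $ fst ij $ snd ij) :: real ^ ('m \<times> 'n)"
  have h: "linear ?h" by (auto intro!: linearI simp: vec_eq_iff)
  have "inj ?h" by (auto simp: inj_def vec_eq_iff)
  have "surj ?h"
    by (rule surjI[of _ "\<lambda>v. \<chi> i j. v $ (i, j)"]) (simp add: vec_eq_iff)
  have surj: "surj (?h \<circ> L z) \<longleftrightarrow> surj (L z)" for z
  proof
    assume "surj (?h \<circ> L z)"
    then have "\<exists>e. ?h M = ?h (L z e)" for M
      using surjD[of "?h \<circ> L z" "?h M"] by auto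
    then have "\<exists>e. M = L z e" for M
      using injD[OF \<open>inj ?h\<close>] by blast
    then show "surj (L z)" by (simp add: surj_def)
  next
    assume "surj (L z)"
    then show "surj (?h \<circ> L z)" by (rule comp_surj[OF _ \<open>surj ?h\<close>])
  qed
  have "generic (\<lambda>z. surj (?h \<circ> L z))"
  proof (rule generic_surj_vec)
    show "linear (?h \<circ> L z)" for z by (rule linear_compose[OF lin h])
    show "polynomial_function (\<lambda>z. (?h \<circ> L z) v)" for v
      using polynomial_function_compose[OF poly polynomial_function_bounded_linear[OF linear_conv_bounded_linear[THEN iffD1, OF h]]]
      by (simp add: o_def)
    show "\<exists>z. surj (?h \<circ> L z)" using ex surj by blast
  qed
  then show ?thesis unfolding surj .
qed

lemma outer_axis_span: "(M :: real ^ 'n ^ 'm) \<in> span (range (\<lambda>(k, l). outer (axis k 1) (axis l 1)))"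
proof -
  have "M = (\<Sum>k\<in>UNIV. \<Sum>l\<in>UNIV. M $ k $ l *\<^sub>R outer (axis k 1) (axis l 1))"
  proof -
    have "M $ k $ l * axis k 1 $ i * axis l 1 $ j = (if l = j then if k = i then M $ k $ l else 0 else 0)"
      for i j k l
      by (simp add: axis_def)
    then show ?thesis by (simp add: vec_eq_iff mult.assoc[symmetric])
  qed
  also have "\<dots> \<in> span (range (\<lambda>(k, l). outer (axis k 1) (axis l 1)))"
    by (intro span_sum span_scale span_base) auto
  finally show ?thesis .
qed

text \<open>The range of this map is the sum of the tangent space \<open>\<real>\<^sup>m \<otimes> b + a \<otimes> \<real>\<^sup>n\<close> of the cone of rank-one
matrices at \<open>a \<otimes> b\<close> and the span of the matrices \<open>w $ j\<close>, \<open>j \<in> J\<close>. Its surjectivity is the transversality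
condition behind both halves of the theorem.\<close>

definition tangent_sum ::
    "real ^ 'm \<Rightarrow> real ^ 'n \<Rightarrow> (real ^ 'n ^ 'm) ^ 'p \<Rightarrow> 'p set \<Rightarrow>
     (real ^ 'm) \<times> (real ^ 'n) \<times> (real ^ 'p) \<Rightarrow> real ^ 'n ^ 'm" where
  "tangent_sum a b w J = (\<lambda>(x, y, \<mu>). outer x b + outer a y + (\<Sum>j\<in>J. \<mu> $ j *\<^sub>R w $ j))"

lemma linear_tangent_sum: "linear (tangent_sum a b w J)"
  unfolding tangent_sum_def
  by (auto intro!: linearI simp: outer_add_left outer_add_right outer_scaleR_left outer_scaleR_right
      algebra_simps sum.distrib scaleR_sum_right)

text \<open>The tangent space at \<open>e\<^sub>k\<^sub>0 \<otimes> e\<^sub>l\<^sub>0\<close> contains the matrix units in row \<open>k0\<close> and in column \<open>l0\<close>. The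
remaining \<open>(m - 1) (n - 1)\<close> matrix units are supplied by the other indices of \<open>J\<close>; this count is where
the lower bound on \<open>p\<close> comes from.\<close>

lemma ex_surj_tangent_sum:
  fixes i :: "'p::finite" and J :: "'p set"
  assumes i: "i \<in> J" and card: "(CARD('m) - 1) * (CARD('n) - 1) + 1 \<le> card J"
  shows "\<exists>(a :: (real ^ 'm) ^ 'p) (b :: (real ^ 'n) ^ 'p).
           surj (tangent_sum (a $ i) (b $ i) (\<chi> j. outer (a $ j) (b $ j)) J)"
proof -
  obtain k0 :: 'm and l0 :: 'n where True by blast
  let ?R = "(UNIV - {k0}) \<times> (UNIV - {l0})"
  have "card ?R = (CARD('m) - 1) * (CARD('n) - 1)"
    by (simp add: card_cartesian_product card_Diff_singleton)
  also have "\<dots> \<le> card (J - {i})"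
    using card i by (simp add: card_Diff_singleton)
  finally obtain h where h: "h ` ?R \<subseteq> J - {i}" "inj_on h ?R"
    using card_le_inj[of ?R "J - {i}"] by auto
  \<comment> \<open>\<open>g j\<close> is the position of the matrix unit placed at index \<open>j\<close>.\<close>
  define g where "g j = (if j = i then (k0, l0) else inv_into ?R h j)" for j
  define a :: "(real ^ 'm) ^ 'p" where "a = (\<chi> j. axis (fst (g j)) 1)"
  define b :: "(real ^ 'n) ^ 'p" where "b = (\<chi> j. axis (snd (g j)) 1)"
  let ?L = "tangent_sum (a $ i) (b $ i) (\<chi> j. outer (a $ j) (b $ j)) J"
  have mem: "v \<in> range ?L" if "?L z = v" for z v
    using that by auto
  have gh: "g (h r) = r" "h r \<in> J" if "r \<in> ?R" for r
    using that h by (auto simp: g_def)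
  have "outer (axis k 1) (axis l 1) \<in> range ?L" for k l
  proof -
    consider "l = l0" | "k = k0" | "(k, l) \<in> ?R" by auto
    then show ?thesis
    proof cases
      case 1
      have "?L (axis k 1, 0, 0) = outer (axis k 1) (axis l 1)"
        by (simp add: tangent_sum_def b_def g_def 1)
      then show ?thesis by (rule mem)
    next
      case 2
      have "?L (0, axis l 1, 0) = outer (axis k 1) (axis l 1)"
        by (simp add: tangent_sum_def a_def g_def 2)
      then show ?thesis by (rule mem)
    next
      case 3
      have "?L (0, 0, axis (h (k, l)) 1) = (\<Sum>j\<in>J. if j = h (k, l) then outer (a $ j) (b $ j) else 0)"
        unfolding tangent_sum_def prod.case
        by (simp only: outer_zero_left outer_zero_right add_0 vec_lambda_beta, rule sum.cong[OF refl])
          (simp add: axis_def)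
      also have "\<dots> = outer (axis k 1) (axis l 1)"
        using gh[OF 3] by (simp add: a_def b_def)
      finally show ?thesis by (rule mem)
    qed
  qed
  then have "range (\<lambda>(k, l). outer (axis k 1) (axis l 1)) \<subseteq> range ?L" by auto
  then have "span (range (\<lambda>(k, l). outer (axis k 1) (axis l 1))) \<subseteq> range ?L"
    by (rule span_minimal) (simp add: linear_subspace_image linear_tangent_sum)
  then have "surj ?L" using outer_axis_span by blast
  then show ?thesis by blast
qed

lemma polynomial_function_vec_nth:
  fixes f :: "'z::euclidean_space \<Rightarrow> 'v::euclidean_space ^ 'k"
  assumes "polynomial_function f"
  shows "polynomial_function (\<lambda>z. f z $ i)"
  using polynomial_function_compose[OF assms polynomial_function_bounded_linear[OF bounded_linear_vec_nth]]
  by (simp add: o_def)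

text \<open>The indices in \<open>I\<close> carry rank-one matrices, the others arbitrary matrices. With
\<open>I = J = UNIV\<close> and all \<open>i\<close> at once, it makes the map from factors to sums of \<open>p\<close> rank-one
tensors a submersion at generic points; in the exchange argument the set \<open>I\<close> grows, and \<open>J\<close> omits the index that is about to join it.\<close>

lemma generic_tangent_sum:
  fixes i :: "'p::finite" and I J :: "'p set"
  assumes "i \<in> J" and "(CARD('m) - 1) * (CARD('n) - 1) + 1 \<le> card J"
  shows "generic (\<lambda>(a :: (real ^ 'm) ^ 'p, b :: (real ^ 'n) ^ 'p, w :: (real ^ 'n ^ 'm) ^ 'p).
    surj (tangent_sum (a $ i) (b $ i) (\<chi> j. if j \<in> I then outer (a $ j) (b $ j) else w $ j) J))"
proof -
  let ?L = "\<lambda>z :: ((real ^ 'm) ^ 'p) \<times> ((real ^ 'n) ^ 'p) \<times> ((real ^ 'n ^ 'm) ^ 'p).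
    tangent_sum (fst z $ i) (fst (snd z) $ i)
      (\<chi> j. if j \<in> I then outer (fst z $ j) (fst (snd z) $ j) else snd (snd z) $ j) J"
  have lin: "bounded_linear (\<lambda>z :: ((real ^ 'm) ^ 'p) \<times> ((real ^ 'n) ^ 'p) \<times> ((real ^ 'n ^ 'm) ^ 'p). fst (snd z))"
    "bounded_linear (\<lambda>z :: ((real ^ 'm) ^ 'p) \<times> ((real ^ 'n) ^ 'p) \<times> ((real ^ 'n ^ 'm) ^ 'p). snd (snd z))"
    by (intro bounded_linear_fst_comp bounded_linear_snd_comp bounded_linear_snd)+
  note pf = polynomial_function_vec_nth[OF polynomial_function_bounded_linear[OF bounded_linear_fst]]
    polynomial_function_vec_nth[OF polynomial_function_bounded_linear[OF lin(1)]]
    polynomial_function_vec_nth[OF polynomial_function_bounded_linear[OF lin(2)]]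
  have "generic (\<lambda>z. surj (?L z))"
  proof (rule generic_surj_mat)
    show "linear (?L z)" for z by (rule linear_tangent_sum)
    show "polynomial_function (\<lambda>z. ?L z v)" for v
    proof -
      have "polynomial_function (\<lambda>z :: ((real ^ 'm) ^ 'p) \<times> ((real ^ 'n) ^ 'p) \<times> ((real ^ 'n ^ 'm) ^ 'p).
          if j \<in> I then outer (fst z $ j) (fst (snd z) $ j) else snd (snd z) $ j)" for j
        by (cases "j \<in> I") (simp_all add: polynomial_function_outer pf)
      then show ?thesis
        unfolding tangent_sum_def case_prod_unfold vec_lambda_beta
        by (intro polynomial_function_add polynomial_function_sum polynomial_function_mult
            polynomial_function_outer pf) auto
    qed
    obtain a :: "(real ^ 'm) ^ 'p" and b :: "(real ^ 'n) ^ 'p"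
      where ab: "surj (tangent_sum (a $ i) (b $ i) (\<chi> j. outer (a $ j) (b $ j)) J)"
      using ex_surj_tangent_sum[OF assms] by blast
    have "surj (?L (a, b, \<chi> j. outer (a $ j) (b $ j)))"
      using ab by (simp cong: if_cong)
    then show "\<exists>z. surj (?L z)" by blast
  qed
  then show ?thesis by (simp add: case_prod_unfold)
qed

section \<open>Open sets of sums of rank-one tensors\<close>

definition span_map :: "'v::real_vector ^ 'p \<Rightarrow> real ^ 'p \<Rightarrow> 'v" where
  "span_map c \<mu> = (\<Sum>i\<in>UNIV. \<mu> $ i *\<^sub>R c $ i)"

lemma linear_span_map: "linear (span_map c)"
  unfolding span_map_def by (auto intro!: linearI simp: algebra_simps sum.distrib scaleR_sum_right)

lemma generic_basis: "generic (\<lambda>c :: (real ^ 'p) ^ 'p. surj (span_map c))"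
proof (rule generic_surj_vec)
  show "linear (span_map c)" for c :: "(real ^ 'p) ^ 'p" by (rule linear_span_map)
  show "polynomial_function (\<lambda>c :: (real ^ 'p) ^ 'p. span_map c v)" for v
    unfolding span_map_def
    by (intro polynomial_function_sum polynomial_function_mult polynomial_function_vec_nth) auto
  have "span_map (\<chi> i. axis i 1) v = v" for v :: "real ^ 'p"
    using basis_expansion[of v] by (simp add: span_map_def scalar_mult_eq_scaleR)
  then have "surj (span_map (\<chi> i. axis i 1) :: real ^ 'p \<Rightarrow> real ^ 'p)" by (metis surjI)
  then show "\<exists>c :: (real ^ 'p) ^ 'p. surj (span_map c)" by blast
qed

text \<open>The derivative of \<open>(a, b, c) \<mapsto> \<Sum>i. a\<^sub>i \<otimes> b\<^sub>i \<otimes> c\<^sub>i\<close> is surjective: as the \<open>c\<^sub>i\<close> form a basis, a tensor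
\<open>X\<close> is \<open>\<Sum>i. M\<^sub>i \<otimes> c\<^sub>i\<close> for some matrices \<open>M\<^sub>i\<close>; each \<open>M\<^sub>i\<close> is a tangent vector at \<open>a\<^sub>i \<otimes> b\<^sub>i\<close>, reached by
varying \<open>a\<^sub>i\<close> and \<open>b\<^sub>i\<close>, plus a combination of the \<open>a\<^sub>j \<otimes> b\<^sub>j\<close>, reached by varying the \<open>c\<^sub>j\<close>.\<close>

lemma sum_tensor3_in_interior:
  fixes a :: "(real ^ 'm) ^ 'p" and b :: "(real ^ 'n) ^ 'p" and c :: "(real ^ 'p) ^ 'p"
  assumes ab: "\<And>i. surj (tangent_sum (a $ i) (b $ i) (\<chi> j. outer (a $ j) (b $ j)) UNIV)"
    and c: "surj (span_map c)"
  shows "(\<Sum>i\<in>UNIV. tensor3 (a $ i) (b $ i) (c $ i)) \<in>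
    interior {T. \<exists>a b. \<exists>c :: (real ^ 'p) ^ 'p. T = (\<Sum>i\<in>UNIV. tensor3 (a $ i) (b $ i) (c $ i))}"
proof -
  let ?F = "\<lambda>z :: ((real ^ 'm) ^ 'p) \<times> ((real ^ 'n) ^ 'p) \<times> ((real ^ 'p) ^ 'p).
    \<Sum>i\<in>UNIV. outer (fst z $ i) (outer (fst (snd z) $ i) (snd (snd z) $ i))"
  let ?D = "\<lambda>h :: ((real ^ 'm) ^ 'p) \<times> ((real ^ 'n) ^ 'p) \<times> ((real ^ 'p) ^ 'p).
    \<Sum>i\<in>UNIV. outer (a $ i) (outer (b $ i) (snd (snd h) $ i) + outer (fst (snd h) $ i) (c $ i))
      + outer (fst h $ i) (outer (b $ i) (c $ i))"
  have lin: "bounded_linear (\<lambda>z :: ((real ^ 'm) ^ 'p) \<times> ((real ^ 'n) ^ 'p) \<times> ((real ^ 'p) ^ 'p). fst z $ i)"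
    "bounded_linear (\<lambda>z :: ((real ^ 'm) ^ 'p) \<times> ((real ^ 'n) ^ 'p) \<times> ((real ^ 'p) ^ 'p). fst (snd z) $ i)"
    "bounded_linear (\<lambda>z :: ((real ^ 'm) ^ 'p) \<times> ((real ^ 'n) ^ 'p) \<times> ((real ^ 'p) ^ 'p). snd (snd z) $ i)"
    for i
    by (intro bounded_linear_compose[OF bounded_linear_vec_nth] bounded_linear_fst_comp
        bounded_linear_snd_comp bounded_linear_snd bounded_linear_fst)+
  have deriv: "(?F has_derivative ?D) (at (a, b, c))"
    by (rule derivative_eq_intros lin[THEN bounded_linear_imp_has_derivative] refl)+ simp
  have cont: "continuous_on UNIV ?F"
    by (intro continuous_intros lin[THEN linear_continuous_on])
  have "X \<in> range ?D" for X :: "real ^ 'p ^ 'n ^ 'm"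
  proof -
    obtain R where R: "linear R" "span_map c \<circ> R = id"
      using linear_surjective_right_inverse[OF linear_span_map c] by blast
    define M where "M i = (\<chi> k l. R (X $ k $ l) $ i)" for i
    have "\<forall>i. \<exists>z. M i = tangent_sum (a $ i) (b $ i) (\<chi> j. outer (a $ j) (b $ j)) UNIV z"
      using surjD[OF ab] by blast
    then obtain s where s: "\<And>i. M i = tangent_sum (a $ i) (b $ i) (\<chi> j. outer (a $ j) (b $ j)) UNIV (s i)"
      by (auto dest!: choice)
    let ?x = "\<lambda>i. fst (s i)" and ?y = "\<lambda>i. fst (snd (s i))" and ?\<mu> = "\<lambda>i. snd (snd (s i))"
    let ?h = "(\<chi> i. ?x i, \<chi> i. ?y i, \<chi> j. \<Sum>i\<in>UNIV. ?\<mu> i $ j *\<^sub>R c $ i)"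
    have "?D ?h $ k $ l = X $ k $ l" for k l
    proof -
      have "X $ k $ l = span_map c (R (X $ k $ l))"
        using R(2) by (metis comp_apply id_apply)
      also have "\<dots> = (\<Sum>i\<in>UNIV. M i $ k $ l *\<^sub>R c $ i)"
        by (simp add: span_map_def M_def)
      also have "\<dots> = (\<Sum>i\<in>UNIV. (?x i $ k * b $ i $ l + a $ i $ k * ?y i $ l
          + (\<Sum>j\<in>UNIV. ?\<mu> i $ j * (a $ j $ k * b $ j $ l))) *\<^sub>R c $ i)"
        by (simp add: s tangent_sum_def case_prod_unfold mult.assoc)
      also have "\<dots> = (\<Sum>i\<in>UNIV. (?x i $ k * b $ i $ l + a $ i $ k * ?y i $ l) *\<^sub>R c $ i)
          + (\<Sum>i\<in>UNIV. \<Sum>j\<in>UNIV. (?\<mu> i $ j * (a $ j $ k * b $ j $ l)) *\<^sub>R c $ i)"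
        by (simp add: scaleR_add_left scaleR_sum_left sum.distrib)
      also have "(\<Sum>i\<in>UNIV. \<Sum>j\<in>UNIV. (?\<mu> i $ j * (a $ j $ k * b $ j $ l)) *\<^sub>R c $ i)
          = (\<Sum>j\<in>UNIV. (a $ j $ k * b $ j $ l) *\<^sub>R (\<Sum>i\<in>UNIV. ?\<mu> i $ j *\<^sub>R c $ i))"
        by (subst sum.swap) (simp add: scaleR_sum_right mult_ac)
      finally show ?thesis
        by (simp add: algebra_simps sum.distrib)
    qed
    then have "X = ?D ?h" by (simp add: vec_eq_iff)
    then show ?thesis by (rule range_eqI)
  qed
  then have "surj ?D" by blast
  moreover have "linear ?D" using deriv has_derivative_linear by blast
  ultimately obtain g where g: "linear g" "?D \<circ> g = id"
    using linear_surjective_right_inverse by blast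
  have bl: "bounded_linear g"
    using g(1) by (simp add: linear_conv_bounded_linear)
  have F: "?F (a, b, c) \<in> interior (range ?F)"
    by (rule sussmann_open_mapping[OF open_UNIV cont UNIV_I deriv bl g(2)]) auto
  have sub: "range ?F \<subseteq> {T. \<exists>a b. \<exists>c :: (real ^ 'p) ^ 'p. T = (\<Sum>i\<in>UNIV. tensor3 (a $ i) (b $ i) (c $ i))}"
    by (auto simp: tensor3_eq_outer)
  have "?F (a, b, c) \<in> interior {T. \<exists>a b. \<exists>c :: (real ^ 'p) ^ 'p. T = (\<Sum>i\<in>UNIV. tensor3 (a $ i) (b $ i) (c $ i))}"
    by (rule subsetD[OF interior_mono[OF sub] F])
  then show ?thesis by (simp only: tensor3_eq_outer fst_conv snd_conv)
qed

lemma sum_of_rank_onesI: "sum_of_rank_ones r (\<Sum>i<r. tensor3 (a i) (b i) (c i))"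
  unfolding sum_of_rank_ones_def by (rule exI[of _ a], rule exI[of _ b], rule exI[of _ c], rule refl)

text \<open>Indexing the summands by a finite type makes the tuple of all factors a point of a Euclidean space, on
which derivatives can be taken.\<close>

lemma sum_of_rank_ones_card:
  fixes T :: "real ^ 'p ^ 'n ^ 'm"
  shows "sum_of_rank_ones CARD('k::finite) T \<longleftrightarrow>
    (\<exists>(a :: (real ^ 'm) ^ 'k) (b :: (real ^ 'n) ^ 'k) (c :: (real ^ 'p) ^ 'k).
      T = (\<Sum>i\<in>UNIV. tensor3 (a $ i) (b $ i) (c $ i)))"
  (is "?l \<longleftrightarrow> ?r")
proof -
  obtain h :: "nat \<Rightarrow> 'k" where h: "bij_betw h {..<CARD('k)} UNIV"
    using ex_bij_betw_nat_finite[of "UNIV :: 'k set"] by (auto simp: atLeast0LessThan)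
  show ?thesis
  proof
    assume ?l
    then obtain a b c where T: "T = (\<Sum>i<CARD('k). tensor3 (a i) (b i) (c i))"
      by (auto simp: sum_of_rank_ones_def)
    let ?g = "inv_into {..<CARD('k)} h"
    have "bij_betw ?g UNIV {..<CARD('k)}" using h by (rule bij_betw_inv_into)
    then have "T = (\<Sum>i\<in>UNIV. tensor3 (a (?g i)) (b (?g i)) (c (?g i)))"
      unfolding T by (rule sum.reindex_bij_betw[symmetric])
    then have "T = (\<Sum>i\<in>UNIV. tensor3 ((\<chi> i. a (?g i)) $ i) ((\<chi> i. b (?g i)) $ i) ((\<chi> i. c (?g i)) $ i))"
      by simp
    then show ?r by blast
  next
    assume ?r
    then obtain a :: "(real ^ 'm) ^ 'k" and b :: "(real ^ 'n) ^ 'k" and c :: "(real ^ 'p) ^ 'k"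
      where T: "T = (\<Sum>i\<in>UNIV. tensor3 (a $ i) (b $ i) (c $ i))" by blast
    have "T = (\<Sum>i<CARD('k). tensor3 (a $ h i) (b $ h i) (c $ h i))"
      unfolding T by (rule sum.reindex_bij_betw[OF h, symmetric])
    then show ?l unfolding sum_of_rank_ones_def by (intro exI)
  qed
qed

lemma sum_of_rank_ones_add:
  "sum_of_rank_ones (r + s) T \<longleftrightarrow> (\<exists>X Y. T = X + Y \<and> sum_of_rank_ones r X \<and> sum_of_rank_ones s Y)"
  (is "?l \<longleftrightarrow> ?r")
proof
  have split: "(\<Sum>i<r + s. f i) = (\<Sum>i<r. f i) + (\<Sum>i<s. f (r + i))" for f :: "nat \<Rightarrow> 'v::comm_monoid_add"
    by (induction s) (simp_all add: add.assoc)
  {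
    assume ?l
    then obtain a b c where
      T: "T = (\<Sum>i<r. tensor3 (a i) (b i) (c i)) + (\<Sum>i<s. tensor3 (a (r + i)) (b (r + i)) (c (r + i)))"
      unfolding sum_of_rank_ones_def split by blast
    show ?r
      using T sum_of_rank_onesI[of r a b c]
        sum_of_rank_onesI[of s "\<lambda>i. a (r + i)" "\<lambda>i. b (r + i)" "\<lambda>i. c (r + i)"] by blast
  }
  {
    assume ?r
    then obtain a b c a' b' c' where
      T: "T = (\<Sum>i<r. tensor3 (a i) (b i) (c i)) + (\<Sum>i<s. tensor3 (a' i) (b' i) (c' i))"
      unfolding sum_of_rank_ones_def by blast
    let ?a = "\<lambda>i. if i < r then a i else a' (i - r)"
    let ?b = "\<lambda>i. if i < r then b i else b' (i - r)"
    let ?c = "\<lambda>i. if i < r then c i else c' (i - r)"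
    have "T = (\<Sum>i<r + s. tensor3 (?a i) (?b i) (?c i))"
      unfolding split T by simp
    then show ?l unfolding sum_of_rank_ones_def by (intro exI)
  }
qed

lemma sum_of_rank_ones_mono:
  assumes "r \<le> s" "sum_of_rank_ones r T"
  shows "sum_of_rank_ones s T"
proof -
  have "sum_of_rank_ones (s - r) 0"
    unfolding sum_of_rank_ones_def
    by (intro exI[of _ "\<lambda>_. 0"]) (simp add: tensor3_eq_outer)
  then have "sum_of_rank_ones (r + (s - r)) T"
    using assms(2) unfolding sum_of_rank_ones_add by (metis add.right_neutral)
  then show ?thesis using assms(1) by simp
qed

lemma sum_of_rank_ones_tensor_rank: "sum_of_rank_ones (tensor_rank T) T"
  unfolding tensor_rank_def using ex_sum_of_rank_ones by (rule LeastI_ex)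

lemma tensor_rank_le_iff: "tensor_rank T \<le> r \<longleftrightarrow> sum_of_rank_ones r T"
proof
  show "sum_of_rank_ones r T" if "tensor_rank T \<le> r"
    using that sum_of_rank_ones_tensor_rank by (rule sum_of_rank_ones_mono)
  show "tensor_rank T \<le> r" if "sum_of_rank_ones r T"
    unfolding tensor_rank_def using that by (rule Least_le)
qed

text \<open>Sums of \<open>r \<ge> p\<close> rank-one tensors are limits of interior points of the set of such sums. Therefore,
if an open set contains a sum of \<open>r\<close> rank-one tensors, it contains an open set of them.\<close>

lemma sum_of_rank_ones_near_interior:
  fixes U :: "(real ^ 'p ^ 'n ^ 'm) set"
  assumes card: "(CARD('m) - 1) * (CARD('n) - 1) + 1 \<le> CARD('p)"
    and r: "CARD('p) \<le> r" and U: "open U" "T \<in> U" and T: "sum_of_rank_ones r T"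
  shows "U \<inter> interior {T. sum_of_rank_ones r T} \<noteq> {}"
proof -
  obtain X Y where XY: "T = X + Y" "sum_of_rank_ones CARD('p) X" "sum_of_rank_ones (r - CARD('p)) Y"
    using T sum_of_rank_ones_add[of "CARD('p)" "r - CARD('p)" T] r by auto
  obtain a :: "(real ^ 'm) ^ 'p" and b :: "(real ^ 'n) ^ 'p" and c :: "(real ^ 'p) ^ 'p"
    where X: "X = (\<Sum>i\<in>UNIV. tensor3 (a $ i) (b $ i) (c $ i))"
    using XY(2) unfolding sum_of_rank_ones_card by blast
  \<comment> \<open>Only \<open>p\<close> of the \<open>r\<close> summands, those making up \<open>X\<close>, are moved.\<close>
  let ?F = "\<lambda>z :: (((real ^ 'm) ^ 'p) \<times> ((real ^ 'n) ^ 'p) \<times> ((real ^ 'n ^ 'm) ^ 'p)) \<times> ((real ^ 'p) ^ 'p).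
    Y + (\<Sum>i\<in>UNIV. outer (fst (fst z) $ i) (outer (fst (snd (fst z)) $ i) (snd z $ i)))"
  have "open (?F -` U)"
    by (intro open_vimage U(1) continuous_intros)
  moreover have "((a, b, 0), c) \<in> ?F -` U"
    using U(2) XY(1) X by (simp add: tensor3_eq_outer add.commute)
  ultimately obtain A B where O: "open A" "open B" "((a, b, 0), c) \<in> A \<times> B" "A \<times> B \<subseteq> ?F -` U"
    by (rule open_prod_elim)
  then have AB: "(a, b, 0) \<in> A" "c \<in> B" by auto
  have "generic (\<lambda>z. \<forall>i\<in>UNIV. case z of (a :: (real ^ 'm) ^ 'p, b :: (real ^ 'n) ^ 'p, w) \<Rightarrow>
    surj (tangent_sum (a $ i) (b $ i) (\<chi> j. if j \<in> UNIV then outer (a $ j) (b $ j) else w $ j) (UNIV :: 'p set)))"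
    using card by (intro generic_Ball generic_tangent_sum) auto
  then obtain a' b' w' where A: "(a', b', w') \<in> A"
    "\<And>i. surj (tangent_sum (a' $ i) (b' $ i) (\<chi> j. outer (a' $ j) (b' $ j)) UNIV)"
    by (rule generic_dense[OF _ O(1) AB(1)]) auto
  obtain c' where B: "c' \<in> B" "surj (span_map c')"
    by (rule generic_dense[OF generic_basis O(2) AB(2)])
  define X' where "X' = (\<Sum>i\<in>UNIV. tensor3 (a' $ i) (b' $ i) (c' $ i))"
  have "(+) Y ` interior {X. sum_of_rank_ones CARD('p) X} \<subseteq> {T. sum_of_rank_ones r T}"
    using interior_subset XY(3) r sum_of_rank_ones_add[of "CARD('p)" "r - CARD('p)"]
    by (fastforce simp: add.commute[of Y])
  then have "(+) Y ` interior {X. sum_of_rank_ones CARD('p) X} \<subseteq> interior {T. sum_of_rank_ones r T}"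
    by (intro interior_maximal open_translation open_interior)
  moreover have "X' \<in> interior {X. sum_of_rank_ones CARD('p) X}"
    using sum_tensor3_in_interior[OF A(2) B(2)] unfolding X'_def sum_of_rank_ones_card .
  ultimately have "Y + X' \<in> interior {T. sum_of_rank_ones r T}" by blast
  moreover have "Y + X' \<in> U"
    using O(4) A(1) B(1) by (auto simp add: X'_def tensor3_eq_outer)
  ultimately show ?thesis by blast
qed

section \<open>Combinations of slices and lower bounds for the rank\<close>

text \<open>The values are the linear combinations of the \<open>p\<close> slices of \<open>T\<close>. A tensor of small rank has a
nontrivial combination of small matrix rank, which is how lower bounds for the tensor rank are obtained.\<close>

definition contract :: "real ^ 'p ^ 'n ^ 'm \<Rightarrow> real ^ 'p \<Rightarrow> real ^ 'n ^ 'm" where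
  "contract T l = (\<chi> i j. T $ i $ j \<bullet> l)"

lemma contract_nth [simp]: "contract T l $ i $ j = T $ i $ j \<bullet> l"
  by (simp add: contract_def)

lemma linear_contract: "linear (contract T)"
  by (auto intro!: linearI simp: vec_eq_iff inner_add_right)

lemma contract_sum_tensor3:
  "contract (\<Sum>i\<in>I. tensor3 (a i) (b i) (c i)) l = (\<Sum>i\<in>I. (c i \<bullet> l) *\<^sub>R outer (a i) (b i))"
  by (simp add: vec_eq_iff tensor3_eq_outer inner_sum_left mult_ac)

text \<open>There are fewer than \<open>p\<close> conditions in requiring that \<open>l\<close> be orthogonal to the first \<open>s\<close> of the vectors
\<open>c i\<close>, and such an \<open>l\<close> makes the first \<open>s\<close> summands disappear.\<close>

lemma contract_rank_ones:
  fixes T :: "real ^ 'p ^ 'n ^ 'm"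
  assumes T: "sum_of_rank_ones r T" and s: "s < CARD('p)"
  obtains l a b c where "l \<noteq> 0" "contract T l = (\<Sum>i\<in>{s..<r}. (c i \<bullet> l) *\<^sub>R outer (a i) (b i))"
proof -
  obtain a b c where T: "T = (\<Sum>i<r. tensor3 (a i) (b i) (c i))"
    using T by (auto simp: sum_of_rank_ones_def)
  have "dim (c ` {..<s}) \<le> s"
    using dim_le_card[of "c ` {..<s}" "c ` {..<s}"] card_image_le[of "{..<s}" c]
    by (simp add: span_superset)
  then have "dim (span (c ` {..<s})) < DIM(real ^ 'p)" using s by simp
  then obtain l where l: "l \<noteq> 0" "\<And>y. y \<in> span (c ` {..<s}) \<Longrightarrow> orthogonal l y"
    using orthogonal_to_subspace_exists[of "c ` {..<s}"] by auto
  have "(\<Sum>i<r. (c i \<bullet> l) *\<^sub>R outer (a i) (b i)) = (\<Sum>i\<in>{s..<r}. (c i \<bullet> l) *\<^sub>R outer (a i) (b i))"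
  proof (rule sum.mono_neutral_right)
    show "\<forall>i\<in>{..<r} - {s..<r}. (c i \<bullet> l) *\<^sub>R outer (a i) (b i) = 0"
    proof
      fix i assume "i \<in> {..<r} - {s..<r}"
      then have "orthogonal l (c i)" by (intro l(2) span_base) auto
      then show "(c i \<bullet> l) *\<^sub>R outer (a i) (b i) = 0"
        by (simp add: orthogonal_def inner_commute)
    qed
  qed auto
  then show ?thesis
    using that[OF l(1)] unfolding T contract_sum_tensor3 by blast
qed

definition independent_slices :: "real ^ 'p ^ 'n ^ 'm \<Rightarrow> bool" where
  "independent_slices T \<longleftrightarrow> (\<forall>l. contract T l = 0 \<longrightarrow> l = 0)"

lemma independent_slices_rank_ge:
  fixes T :: "real ^ 'p ^ 'n ^ 'm"
  assumes "independent_slices T" "sum_of_rank_ones r T"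
  shows "CARD('p) \<le> r"
proof (rule ccontr)
  assume "\<not> CARD('p) \<le> r"
  then have "r < CARD('p)" by simp
  with assms(2) obtain l :: "real ^ 'p" and a b c
    where "l \<noteq> 0" "contract T l = (\<Sum>i\<in>{r..<r}. (c i \<bullet> l) *\<^sub>R outer (a i) (b i))"
    by (rule contract_rank_ones)
  then show False using assms(1) by (auto simp: independent_slices_def)
qed

text \<open>Independence of the slices amounts to the entries \<open>T $ i $ j\<close> spanning \<open>\<real>\<^sup>p\<close>, that is, to
surjectivity of a linear map that depends linearly on \<open>T\<close>.\<close>

lemma independent_slices_dense:
  fixes U :: "(real ^ 'p ^ 'n ^ 'm) set"
  assumes p: "CARD('p) \<le> CARD('m) * CARD('n)" and U: "open U" "T \<in> U"
  obtains T' where "T' \<in> U" "independent_slices T'"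
proof -
  let ?L = "\<lambda>T :: real ^ 'p ^ 'n ^ 'm. \<lambda>M :: real ^ 'n ^ 'm. \<Sum>i\<in>UNIV. \<Sum>j\<in>UNIV. M $ i $ j *\<^sub>R T $ i $ j"
  have lin: "linear (?L T)" for T
    by (auto intro!: linearI simp: algebra_simps sum.distrib scaleR_sum_right)
  have "generic (\<lambda>T. surj (?L T))"
  proof (rule generic_surj_vec)
    show "linear (?L T)" for T by (rule lin)
    show "polynomial_function (\<lambda>T. ?L T M)" for M
      by (intro polynomial_function_sum polynomial_function_mult polynomial_function_vec_nth) auto
    obtain h :: "'p \<Rightarrow> 'm \<times> 'n" where h: "inj h"
      using card_le_inj[of "UNIV :: 'p set" "UNIV :: ('m \<times> 'n) set"] p by auto
    define T :: "real ^ 'p ^ 'n ^ 'm" where "T = (\<chi> i j. axis (inv h (i, j)) 1)"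
    have "?L T (axis i (axis j 1)) = T $ i $ j" for i j
    proof -
      have "axis i (axis j 1) $ i' $ j' *\<^sub>R x = (if j' = j then if i' = i then x else 0 else 0)"
        for i' j' and x :: "real ^ 'p"
        by (simp add: axis_def)
      then show ?thesis by simp
    qed
    then have "?L T (\<Sum>k\<in>UNIV. v $ k *\<^sub>R axis (fst (h k)) (axis (snd (h k)) 1))
        = (\<Sum>k\<in>UNIV. v $ k *\<^sub>R axis k 1)" for v
      by (simp only: linear_sum[OF lin] linear_scale[OF lin]) (simp add: T_def h)
    then have "?L T (\<Sum>k\<in>UNIV. v $ k *\<^sub>R axis (fst (h k)) (axis (snd (h k)) 1)) = v" for v
      using basis_expansion[of v] by (simp only: scalar_mult_eq_scaleR)
    then have "surj (?L T)" by (rule surjI)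
    then show "\<exists>T. surj (?L T)" by (rule exI)
  qed
  then obtain T' where T': "surj (?L T')" "T' \<in> U"
    by (rule generic_dense[OF _ U])
  have "independent_slices T'"
    unfolding independent_slices_def
  proof (intro allI impI)
    fix l assume "contract T' l = 0"
    then have "T' $ i $ j \<bullet> l = 0" for i j by (metis contract_nth zero_index)
    moreover obtain M where "l = ?L T' M" using surjD[OF T'(1), of l] by blast
    ultimately have "l \<bullet> l = 0"
      by (subst \<open>l = ?L T' M\<close>) (simp add: inner_sum_left)
    then show "l = 0" by simp
  qed
  then show ?thesis using that T' by blast
qed

text \<open>The exceptional tensors are the projection of a closed set along the compact sphere.\<close>

lemma open_contract_avoids:
  fixes K :: "(real ^ 'n ^ 'm) set"
  assumes "closed K"
  shows "open {T :: real ^ 'p ^ 'n ^ 'm. \<forall>l\<in>sphere 0 1. contract T l \<notin> K}"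
proof -
  have "continuous_on UNIV (\<lambda>z :: (real ^ 'p) \<times> (real ^ 'p ^ 'n ^ 'm). contract (snd z) (fst z))"
    unfolding contract_def by (intro continuous_on_vec_lambda continuous_intros)
  then have "closed ((\<lambda>z :: (real ^ 'p) \<times> (real ^ 'p ^ 'n ^ 'm). contract (snd z) (fst z)) -` K)"
    using assms by (simp add: continuous_on_closed_vimage)
  then have "closed {T. \<exists>l. l \<in> sphere 0 1 \<and>
      (l, T) \<in> (\<lambda>z :: (real ^ 'p) \<times> (real ^ 'p ^ 'n ^ 'm). contract (snd z) (fst z)) -` K}"
    using closed_compact_projection[OF compact_sphere] by blast
  moreover have "{T. \<exists>l. l \<in> sphere 0 1 \<and>
      (l, T) \<in> (\<lambda>z :: (real ^ 'p) \<times> (real ^ 'p ^ 'n ^ 'm). contract (snd z) (fst z)) -` K}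
    = - {T :: real ^ 'p ^ 'n ^ 'm. \<forall>l\<in>sphere 0 1. contract T l \<notin> K}" by auto
  ultimately show ?thesis by (simp add: open_closed)
qed

lemma contract_avoids_iff:
  assumes K: "\<And>r M. M \<in> K \<Longrightarrow> r *\<^sub>R M \<in> K"
  shows "(\<forall>l\<in>sphere 0 1. contract T l \<notin> K) \<longleftrightarrow> (\<forall>l. l \<noteq> 0 \<longrightarrow> contract T l \<notin> K)"
proof (intro iffI allI impI notI ballI)
  fix l assume l: "l \<noteq> 0" "contract T l \<in> K" and *: "\<forall>l\<in>sphere 0 1. contract T l \<notin> K"
  have "contract T ((1 / norm l) *\<^sub>R l) \<in> K"
    using K[OF l(2)] by (simp add: linear_scale[OF linear_contract])
  moreover have "(1 / norm l) *\<^sub>R l \<in> sphere 0 1" using l(1) by simp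
  ultimately show False using * by blast
next
  fix l assume "\<forall>l. l \<noteq> 0 \<longrightarrow> contract T l \<notin> K" "l \<in> sphere 0 1" "contract T l \<in> K"
  then show False by (metis mem_sphere_0 norm_zero zero_neq_one)
qed

lemma independent_slices_iff: "independent_slices T \<longleftrightarrow> (\<forall>l\<in>sphere 0 1. contract T l \<notin> {0})"
  by (subst contract_avoids_iff) (auto simp: independent_slices_def)

section \<open>From nonsingular bilinear maps to typical ranks\<close>

text \<open>Sums of \<open>p\<close> rank-one tensors have interior, and rank less than \<open>p\<close> is excluded on the dense open
set of tensors with independent slices.\<close>

lemma typical_rank_card:
  assumes "(CARD('m) - 1) * (CARD('n) - 1) + 1 \<le> CARD('p)" and "CARD('p) \<le> CARD('m) * CARD('n)"
  shows "typical_rank TYPE(real ^ 'p ^ 'n ^ 'm) CARD('p)"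
proof -
  let ?V = "interior {T :: real ^ 'p ^ 'n ^ 'm. sum_of_rank_ones CARD('p) T}"
  have "sum_of_rank_ones CARD('p) (\<Sum>i<CARD('p). tensor3 0 0 0 :: real ^ 'p ^ 'n ^ 'm)"
    by (rule sum_of_rank_onesI)
  then have "?V \<noteq> {}"
    using sum_of_rank_ones_near_interior[OF assms(1) order_refl open_UNIV UNIV_I] by blast
  then obtain T where T: "T \<in> ?V" "independent_slices T"
    using independent_slices_dense[OF assms(2) open_interior] by blast
  let ?U = "?V \<inter> {T. \<forall>l\<in>sphere 0 1. contract T l \<notin> {0}}"
  have "open ?U" by (intro open_Int open_interior open_contract_avoids closed_singleton)
  moreover have "T \<in> ?U" using T independent_slices_iff by blast
  then have "?U \<noteq> {}" by blast
  moreover have "?U \<subseteq> {T. tensor_rank T = CARD('p)}"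
  proof safe
    fix T assume T: "T \<in> ?V" "\<forall>l\<in>sphere 0 1. contract T l \<notin> {0}"
    have "tensor_rank T \<le> CARD('p)"
      using T(1) interior_subset unfolding tensor_rank_le_iff by blast
    moreover have "CARD('p) \<le> tensor_rank T"
      using T(2) sum_of_rank_ones_tensor_rank independent_slices_rank_ge independent_slices_iff by blast
    ultimately show "tensor_rank T = CARD('p)" by simp
  qed
  ultimately show ?thesis unfolding typical_rank_def by blast
qed

definition rank_one_cone :: "(real ^ 'n ^ 'm) set" where
  "rank_one_cone = {M. \<exists>x y. M = outer x y}"

lemma outer_in_rank_one_cone [simp]: "outer x y \<in> rank_one_cone"
  unfolding rank_one_cone_def by auto

lemma scaleR_rank_one_cone: "M \<in> rank_one_cone \<Longrightarrow> r *\<^sub>R M \<in> rank_one_cone"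
  unfolding rank_one_cone_def mem_Collect_eq by (metis outer_scaleR_left)

text \<open>The \<open>2 \<times> 2\<close> minors exhibit the cone as a closed set.\<close>

lemma rank_one_cone_minors:
  "rank_one_cone = {M :: real ^ 'n ^ 'm. \<forall>i j k l. M $ i $ j * M $ k $ l = M $ i $ l * M $ k $ j}"
proof (intro equalityI subsetI)
  fix M :: "real ^ 'n ^ 'm"
  assume "M \<in> {M. \<forall>i j k l. M $ i $ j * M $ k $ l = M $ i $ l * M $ k $ j}"
  then have minors: "M $ i $ j * M $ k $ l = M $ i $ l * M $ k $ j" for i j k l by blast
  show "M \<in> rank_one_cone"
  proof (cases "M = 0")
    case True
    then show ?thesis using outer_in_rank_one_cone[of 0 0] by simp
  next
    case False
    then obtain k l where kl: "M $ k $ l \<noteq> 0" by (auto simp: vec_eq_iff)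
    have "M = outer (\<chi> i. M $ i $ l / M $ k $ l) (M $ k)"
      using minors[of _ _ k l] kl by (simp add: vec_eq_iff field_simps)
    then show ?thesis by (metis outer_in_rank_one_cone)
  qed
qed (auto simp: rank_one_cone_def)

lemma closed_rank_one_cone: "closed (rank_one_cone :: (real ^ 'n ^ 'm) set)"
  unfolding rank_one_cone_minors
  by (intro closed_Collect_all closed_Collect_eq continuous_intros)

text \<open>In a sum of \<open>p\<close> rank-one tensors, a suitable combination of the slices retains only one of the
\<open>p\<close> matrices \<open>a i \<otimes> b i\<close>.\<close>

lemma rank_one_avoiding_rank_gt:
  fixes T :: "real ^ 'p ^ 'n ^ 'm"
  assumes "\<And>l. l \<noteq> 0 \<Longrightarrow> contract T l \<notin> rank_one_cone"
  shows "\<not> sum_of_rank_ones CARD('p) T"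
proof
  assume T: "sum_of_rank_ones CARD('p) T"
  have s: "CARD('p) - 1 < CARD('p)" by simp
  from T s obtain l :: "real ^ 'p" and a b c where l: "l \<noteq> 0"
    "contract T l = (\<Sum>i\<in>{CARD('p) - 1..<CARD('p)}. (c i \<bullet> l) *\<^sub>R outer (a i) (b i))"
    by (rule contract_rank_ones)
  have "{CARD('p) - 1..<CARD('p)} = {CARD('p) - 1}" by auto
  then have "contract T l \<in> rank_one_cone"
    using l(2) by (simp add: scaleR_rank_one_cone)
  then show False using assms l(1) by blast
qed

lemma bilinear_eq_inner_outer:
  fixes h :: "real ^ 'm \<Rightarrow> real ^ 'n \<Rightarrow> real"
  assumes "bilinear h"
  shows "h x y = (\<chi> k l. h (axis k 1) (axis l 1)) \<bullet> outer x y"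
proof -
  have lin: "linear (\<lambda>x. h x y)" "linear (h x)" for x y
    using assms by (auto simp: bilinear_def)
  have x: "x = (\<Sum>k\<in>UNIV. x $ k *\<^sub>R axis k 1)" for x :: "real ^ 'k"
    using basis_expansion[of x] by (simp add: scalar_mult_eq_scaleR)
  have "h x y = (\<Sum>k\<in>UNIV. x $ k * h (axis k 1) y)"
    by (subst x[of x]) (simp add: linear_sum[OF lin(1)] linear_scale[OF lin(1)])
  also have "\<dots> = (\<Sum>k\<in>UNIV. x $ k * (\<Sum>l\<in>UNIV. y $ l * h (axis k 1) (axis l 1)))"
    by (subst x[of y]) (simp add: linear_sum[OF lin(2)] linear_scale[OF lin(2)])
  finally show ?thesis
    by (simp add: inner_vec_def sum_distrib_left mult_ac)
qed

lemma outer_eq_0_iff: "outer x (y :: real ^ 'n) = 0 \<longleftrightarrow> x = 0 \<or> y = 0"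
  by (auto simp: vec_eq_iff)

text \<open>Each component of \<open>f\<close> is the inner product of \<open>x \<otimes> y\<close> with a matrix. The matrices orthogonal to all
of these form a space of dimension at least \<open>m n - r \<ge> p\<close> in which nonsingularity leaves no rank-one matrix, and
\<open>p\<close> independent elements of it are taken as slices.\<close>

lemma nonsingular_imp_rank_one_avoiding:
  fixes f :: "real ^ 'm \<Rightarrow> real ^ 'n \<Rightarrow> nat \<Rightarrow> real"
  assumes f: "nonsingular_bilinear_map r f" and r: "r + CARD('p) \<le> CARD('m) * CARD('n)"
  obtains T :: "real ^ 'p ^ 'n ^ 'm" where "\<And>l. l \<noteq> 0 \<Longrightarrow> contract T l \<notin> rank_one_cone"
proof -
  define A where "A i = (\<chi> k l. f (axis k 1) (axis l 1) i)" for i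
  have A: "f x y i = A i \<bullet> outer x y" for x y i
    using f bilinear_eq_inner_outer unfolding nonsingular_bilinear_map_def A_def by blast
  let ?S = "span (A ` {..<r})"
  define W where "W = {M \<in> UNIV. \<forall>a\<in>?S. orthogonal a M}"
  have W0: "outer x y = 0" if "outer x y \<in> W" for x y
  proof -
    have "f x y i = 0" for i
    proof (cases "i < r")
      case True
      then have "A i \<in> ?S" by (intro span_base) auto
      then show ?thesis using that by (simp add: A W_def orthogonal_def)
    next
      case False
      then show ?thesis
        using f by (auto simp: nonsingular_bilinear_map_def topspace_Euclidean_space)
    qed
    then have "x = 0 \<or> y = 0"
      using f unfolding nonsingular_bilinear_map_def by blast
    then show ?thesis by (simp add: outer_eq_0_iff)
  qed
  have "dim ?S \<le> r"
    using dim_le_card[of ?S "A ` {..<r}"] card_image_le[of "{..<r}" A] by simp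
  moreover have "dim W + dim ?S = DIM(real ^ 'n ^ 'm)"
    using dim_subspace_orthogonal_to_vectors[of ?S "UNIV :: (real ^ 'n ^ 'm) set"] by (simp add: dim_UNIV W_def)
  ultimately have "CARD('p) \<le> dim W" using r by simp
  moreover obtain B where B: "B \<subseteq> W" "independent B" "card B = dim W"
    by (rule basis_exists[of W])
  ultimately obtain w :: "'p \<Rightarrow> real ^ 'n ^ 'm" where w: "range w \<subseteq> B" "inj w"
    using card_le_inj[of "UNIV :: 'p set" B] independent_imp_finite[OF B(2)] by auto
  define T where "T = (\<chi> i j k. w k $ i $ j)"
  have T: "contract T l = (\<Sum>k\<in>UNIV. l $ k *\<^sub>R w k)" for l
    by (simp add: vec_eq_iff T_def inner_vec_def mult.commute)
  have "subspace W"
    unfolding W_def by (auto simp: subspace_def orthogonal_clauses)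
  have "contract T l \<notin> rank_one_cone" if "l \<noteq> 0" for l
  proof
    assume "contract T l \<in> rank_one_cone"
    moreover have "contract T l \<in> W"
      unfolding T using w(1) B(1) by (intro subspace_sum[OF \<open>subspace W\<close>] subspace_scale[OF \<open>subspace W\<close>]) blast
    ultimately have "contract T l = 0" using W0 by (auto simp: rank_one_cone_def)
    then have "(\<Sum>v\<in>range w. l $ inv w v *\<^sub>R v) = 0"
      by (simp add: T sum.reindex[OF w(2)] w(2))
    then have "l $ inv w (w k) = 0" for k
      using independentD[OF independent_mono[OF B(2) w(1)], of "range w" "\<lambda>v. l $ inv w v" "w k"] by simp
    then have "l = 0" using w(2) by (simp add: vec_eq_iff)
    then show False using that by blast
  qed
  then show ?thesis using that by blast
qed

text \<open>On the open set of tensors whose slices have no combination of rank at most one, all ranks exceed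
\<open>p\<close>; the smallest rank \<open>r\<close> that occurs there is typical, because the sums of \<open>r\<close> rank-one tensors have an
interior point there and none of these tensors is a shorter sum.\<close>

lemma nonsingular_imp_plural_typical_ranks:
  fixes f :: "real ^ 'm \<Rightarrow> real ^ 'n \<Rightarrow> nat \<Rightarrow> real"
  assumes p: "(CARD('m) - 1) * (CARD('n) - 1) + 1 \<le> CARD('p)" "CARD('p) \<le> CARD('m) * CARD('n)"
    and f: "nonsingular_bilinear_map (CARD('m) * CARD('n) - CARD('p)) f"
  shows "plural_typical_ranks TYPE(real ^ 'p ^ 'n ^ 'm)"
proof -
  let ?U = "{T :: real ^ 'p ^ 'n ^ 'm. \<forall>l\<in>sphere 0 1. contract T l \<notin> rank_one_cone}"
  have U: "T \<in> ?U \<longleftrightarrow> (\<forall>l. l \<noteq> 0 \<longrightarrow> contract T l \<notin> rank_one_cone)" for T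
    by (simp add: contract_avoids_iff scaleR_rank_one_cone)
  have "open ?U" by (intro open_contract_avoids closed_rank_one_cone)
  obtain T :: "real ^ 'p ^ 'n ^ 'm" where "\<And>l. l \<noteq> 0 \<Longrightarrow> contract T l \<notin> rank_one_cone"
    using p(2) by (elim nonsingular_imp_rank_one_avoiding[OF f, rotated]) simp
  then have "T \<in> ?U" using U by blast
  define r where "r = (LEAST r. \<exists>T\<in>?U. sum_of_rank_ones r T)"
  have "\<exists>r. \<exists>T\<in>?U. sum_of_rank_ones r T"
    using \<open>T \<in> ?U\<close> sum_of_rank_ones_tensor_rank by blast
  then have "\<exists>T\<in>?U. sum_of_rank_ones r T" unfolding r_def by (rule LeastI_ex)
  then obtain T' where T': "T' \<in> ?U" "sum_of_rank_ones r T'" by blast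
  have "\<not> r \<le> CARD('p)"
    using sum_of_rank_ones_mono[OF _ T'(2)] rank_one_avoiding_rank_gt T'(1) U by blast
  have "typical_rank TYPE(real ^ 'p ^ 'n ^ 'm) r"
    unfolding typical_rank_def
  proof (intro exI conjI)
    show "open (?U \<inter> interior {T. sum_of_rank_ones r T})"
      using \<open>open ?U\<close> by blast
    show "?U \<inter> interior {T. sum_of_rank_ones r T} \<noteq> {}"
      using sum_of_rank_ones_near_interior[OF p(1) _ \<open>open ?U\<close> T'] \<open>\<not> r \<le> CARD('p)\<close> by simp
    show "?U \<inter> interior {T. sum_of_rank_ones r T} \<subseteq> {T. tensor_rank T = r}"
    proof
      fix T assume T: "T \<in> ?U \<inter> interior {T. sum_of_rank_ones r T}"
      then have "tensor_rank T \<le> r"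
        using interior_subset unfolding tensor_rank_le_iff by blast
      moreover have "r \<le> tensor_rank T"
        unfolding r_def using T sum_of_rank_ones_tensor_rank by (intro Least_le) blast
      ultimately show "T \<in> {T. tensor_rank T = r}" by simp
    qed
  qed
  moreover have "typical_rank TYPE(real ^ 'p ^ 'n ^ 'm) CARD('p)"
    using p by (rule typical_rank_card)
  ultimately show ?thesis
    using \<open>\<not> r \<le> CARD('p)\<close> unfolding plural_typical_ranks_def by (metis order_refl)
qed

section \<open>From typical ranks to nonsingular bilinear maps\<close>

definition matrix_tensor :: "real ^ 'n ^ 'm \<Rightarrow> real ^ 'p \<Rightarrow> real ^ 'p ^ 'n ^ 'm" where
  "matrix_tensor M c = (\<chi> i j. M $ i $ j *\<^sub>R c)"

lemma matrix_tensor_nth [simp]: "matrix_tensor M c $ i $ j = M $ i $ j *\<^sub>R c"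
  by (simp add: matrix_tensor_def)

lemma matrix_tensor_outer: "matrix_tensor (outer a b) c = tensor3 a b c"
  by (simp add: vec_eq_iff tensor3_def)

lemma continuous_on_matrix_tensor [continuous_intros]:
  "continuous_on S f \<Longrightarrow> continuous_on S (\<lambda>z. matrix_tensor (f z) c)"
  unfolding matrix_tensor_def by (intro continuous_on_vec_lambda continuous_intros)

text \<open>The summand of \<open>w i\<close> is distributed over the others, at the cost of new vectors \<open>c j\<close>.\<close>

lemma matrix_tensor_sum_exchange:
  fixes w :: "'p::finite \<Rightarrow> real ^ 'n ^ 'm"
  assumes w: "w i = s *\<^sub>R v + (\<Sum>j\<in>UNIV - {i}. \<nu> j *\<^sub>R w j)"
  shows "(\<Sum>j\<in>UNIV. matrix_tensor (w j) (c j)) =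
    (\<Sum>j\<in>UNIV. matrix_tensor ((w(i := v)) j) (if j = i then s *\<^sub>R c i else c j + \<nu> j *\<^sub>R c i))"
proof -
  have split: "sum f UNIV = f i + sum f (UNIV - {i})" for f :: "'p \<Rightarrow> real ^ 'q ^ 'n ^ 'm"
    by (simp add: sum.remove)
  have "matrix_tensor (w i) (c i) = matrix_tensor v (s *\<^sub>R c i)
      + (\<Sum>j\<in>UNIV - {i}. matrix_tensor (w j) (\<nu> j *\<^sub>R c i))"
    by (subst w) (simp add: vec_eq_iff scaleR_add_left scaleR_sum_left mult_ac)
  moreover have "matrix_tensor (w j) (c j + \<nu> j *\<^sub>R c i)
      = matrix_tensor (w j) (c j) + matrix_tensor (w j) (\<nu> j *\<^sub>R c i)" for j
    by (simp add: vec_eq_iff scaleR_add_right)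
  ultimately show ?thesis
    unfolding split by (simp add: sum.distrib)
qed

text \<open>Suppose that a tensor in \<open>U\<close> has its slices in the span of \<open>p\<close> matrices \<open>W j\<close>, of which those with
\<open>j \<in> I\<close> have rank at most one. After moving the matrices a little, the tangent space at \<open>W i\<close> and the
\<open>W j\<close> with \<open>j \<noteq> k\<close> together span all matrices; omitting \<open>k\<close> is possible because
\<open>p - 1 \<ge> (m - 1) (n - 1) + 1\<close>. The open mapping theorem then makes \<open>(x, y, \<mu>) \<mapsto> x \<otimes> y + \<Sum>j\<noteq>k. \<mu>\<^sub>j W j\<close> reach
\<open>W i + t W k\<close> for small \<open>t > 0\<close>. This expresses \<open>W k\<close> by \<open>x \<otimes> y\<close> and the other \<open>W j\<close>, so that the
rank-one matrix \<open>x \<otimes> y\<close> can take the place of \<open>W k\<close> without changing the tensor.\<close>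

lemma rank_one_exchange:
  fixes a :: "(real ^ 'm) ^ 'p" and b :: "(real ^ 'n) ^ 'p"
  assumes card: "(CARD('m) - 1) * (CARD('n) - 1) + 2 \<le> CARD('p)"
    and U: "open U" "(\<Sum>j\<in>UNIV. matrix_tensor (if j \<in> I then outer (a $ j) (b $ j) else w $ j) (c j)) \<in> U"
    and i: "i \<in> I" "k \<notin> I"
  shows "\<exists>(a :: (real ^ 'm) ^ 'p) (b :: (real ^ 'n) ^ 'p) w c.
    (\<Sum>j\<in>UNIV. matrix_tensor (if j \<in> insert k I then outer (a $ j) (b $ j) else w $ j) (c j)) \<in> U"
proof -
  let ?w = "\<lambda>z :: ((real ^ 'm) ^ 'p) \<times> ((real ^ 'n) ^ 'p) \<times> ((real ^ 'n ^ 'm) ^ 'p). \<lambda>j.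
    if j \<in> I then outer (fst z $ j) (fst (snd z) $ j) else snd (snd z) $ j"
  let ?F = "\<lambda>z. \<Sum>j\<in>UNIV. matrix_tensor (?w z j) (c j)"
  let ?J = "UNIV - {k}"
  have "continuous_on UNIV (\<lambda>z. ?w z j)" for j
    by (cases "j \<in> I") (auto intro!: continuous_intros)
  then have opn: "open (?F -` U)"
    by (intro open_vimage U(1) continuous_intros)
  have mem: "(a, b, w) \<in> ?F -` U" using U(2) by (simp cong: if_cong)
  have gen: "generic (\<lambda>(a :: (real ^ 'm) ^ 'p, b :: (real ^ 'n) ^ 'p, w :: (real ^ 'n ^ 'm) ^ 'p).
    surj (tangent_sum (a $ i) (b $ i) (\<chi> j. if j \<in> I then outer (a $ j) (b $ j) else w $ j) ?J))"
    using card i by (intro generic_tangent_sum) (auto simp: card_Diff_singleton)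
  obtain z where z: "case z of (a, b, w) \<Rightarrow>
      surj (tangent_sum (a $ i) (b $ i) (\<chi> j. if j \<in> I then outer (a $ j) (b $ j) else w $ j) ?J)"
    "z \<in> ?F -` U"
    by (rule generic_dense[OF gen opn mem])
  obtain a' b' w' where z': "z = (a', b', w')" by (cases z)
  define W where "W j = (if j \<in> I then outer (a' $ j) (b' $ j) else w' $ j)" for j
  have surj: "surj (tangent_sum (a' $ i) (b' $ i) (\<chi> j. W j) ?J)"
    using z(1) by (simp add: z' W_def)
  let ?G = "\<lambda>u :: (real ^ 'm) \<times> (real ^ 'n) \<times> (real ^ 'p).
    outer (fst u) (fst (snd u)) + (\<Sum>j\<in>?J. (snd (snd u) $ j) *\<^sub>R W j)"
  have lin: "bounded_linear (\<lambda>u :: (real ^ 'm) \<times> (real ^ 'n) \<times> (real ^ 'p). fst (snd u))"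
    "bounded_linear (\<lambda>u :: (real ^ 'm) \<times> (real ^ 'n) \<times> (real ^ 'p). snd (snd u) $ j)" for j
    by (intro bounded_linear_compose[OF bounded_linear_vec_nth] bounded_linear_fst_comp
        bounded_linear_snd_comp bounded_linear_snd)+
  let ?u = "(a' $ i, b' $ i, 0 :: real ^ 'p)"
  have "(?G has_derivative (\<lambda>h. outer (a' $ i) (fst (snd h)) + outer (fst h) (b' $ i)
      + (\<Sum>j\<in>?J. (snd (snd h) $ j) *\<^sub>R W j))) (at ?u)"
    by (rule derivative_eq_intros lin[THEN bounded_linear_imp_has_derivative] refl)+ simp
  also have "(\<lambda>h. outer (a' $ i) (fst (snd h)) + outer (fst h) (b' $ i)
      + (\<Sum>j\<in>?J. (snd (snd h) $ j) *\<^sub>R W j)) = tangent_sum (a' $ i) (b' $ i) (\<chi> j. W j) ?J"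
    by (auto simp: tangent_sum_def)
  finally have deriv: "(?G has_derivative tangent_sum (a' $ i) (b' $ i) (\<chi> j. W j) ?J) (at ?u)" .
  have cont: "continuous_on UNIV ?G"
    by (intro continuous_intros lin[THEN linear_continuous_on])
  obtain g where g: "linear g" "tangent_sum (a' $ i) (b' $ i) (\<chi> j. W j) ?J \<circ> g = id"
    using linear_surjective_right_inverse[OF linear_tangent_sum surj] by blast
  have bl: "bounded_linear g"
    using g(1) by (simp add: linear_conv_bounded_linear)
  have "?G ?u \<in> interior (range ?G)"
    by (rule sussmann_open_mapping[OF open_UNIV cont UNIV_I deriv bl g(2)]) auto
  then have int: "W i \<in> interior (range ?G)"
    using i by (simp add: W_def)
  have "open ((\<lambda>t::real. W i + t *\<^sub>R W k) -` interior (range ?G))"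
    by (intro open_vimage open_interior continuous_intros)
  moreover have "0 \<in> (\<lambda>t::real. W i + t *\<^sub>R W k) -` interior (range ?G)"
    using int by simp
  ultimately obtain e where e: "e > 0" "ball 0 e \<subseteq> (\<lambda>t::real. W i + t *\<^sub>R W k) -` interior (range ?G)"
    using open_contains_ball by blast
  define t where "t = e / 2"
  have t: "t > 0" using e(1) by (simp add: t_def)
  have "t \<in> ball 0 e" using e(1) by (simp add: t_def)
  then have "W i + t *\<^sub>R W k \<in> interior (range ?G)" using e(2) by blast
  then have "W i + t *\<^sub>R W k \<in> range ?G" using interior_subset by blast
  then obtain u where u: "W i + t *\<^sub>R W k = ?G u" by blast
  obtain x y \<mu> where xy: "u = (x, y, \<mu>)" by (cases u)
  \<comment> \<open>Solving \<open>W i + t W k = x \<otimes> y + \<Sum>j\<noteq>k. \<mu>\<^sub>j W j\<close> for \<open>W k\<close> lowers the coefficient of \<open>W i\<close> by one.\<close>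
  define \<nu> where "\<nu> j = (\<mu> $ j - (if j = i then 1 else 0)) / t" for j
  have "(\<Sum>j\<in>?J. (if j = i then 1 else 0 :: real) *\<^sub>R W j) = (\<Sum>j\<in>?J. if j = i then W j else 0)"
    by (intro sum.cong) auto
  also have "\<dots> = W i" using i by auto
  finally have Wi: "(\<Sum>j\<in>?J. (if j = i then 1 else 0 :: real) *\<^sub>R W j) = W i" .
  have "t *\<^sub>R W k = outer x y + (\<Sum>j\<in>?J. \<mu> $ j *\<^sub>R W j) - W i"
    using u by (simp add: xy algebra_simps)
  also have "\<dots> = outer x y + (\<Sum>j\<in>?J. (\<mu> $ j - (if j = i then 1 else 0)) *\<^sub>R W j)"
    by (simp only: scaleR_diff_left sum_subtractf Wi add_diff_eq)
  also have "\<dots> = t *\<^sub>R ((1 / t) *\<^sub>R outer x y + (\<Sum>j\<in>?J. \<nu> j *\<^sub>R W j))"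
    using t by (simp add: \<nu>_def scaleR_add_right scaleR_sum_right)
  finally have Wk: "W k = (1 / t) *\<^sub>R outer x y + (\<Sum>j\<in>?J. \<nu> j *\<^sub>R W j)"
    using t by simp
  let ?a = "\<chi> j. if j = k then x else a' $ j" and ?b = "\<chi> j. if j = k then y else b' $ j"
  have W': "(W(k := outer x y)) j = (if j \<in> insert k I then outer (?a $ j) (?b $ j) else w' $ j)" for j
    by (simp add: W_def)
  have "?F z = (\<Sum>j\<in>UNIV. matrix_tensor (W j) (c j))"
    by (simp add: z' W_def cong: if_cong)
  then have "(\<Sum>j\<in>UNIV. matrix_tensor (W j) (c j)) \<in> U" using z(2) by simp
  then show ?thesis
    unfolding matrix_tensor_sum_exchange[of W k "1 / t" "outer x y" \<nu> c, OF Wk] W' by (intro exI)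
qed

text \<open>If the \<open>p\<close>-dimensional span \<open>S\<close> of the slices contained no rank-one matrix, pairing \<open>x \<otimes> y\<close> with a
basis of the orthogonal complement of \<open>S\<close> would be a nonsingular bilinear map.\<close>

lemma independent_slices_meets_rank_one_cone:
  fixes T :: "real ^ 'p ^ 'n ^ 'm"
  assumes T: "independent_slices T"
    and no: "\<nexists>f :: real ^ 'm \<Rightarrow> real ^ 'n \<Rightarrow> nat \<Rightarrow> real.
      nonsingular_bilinear_map (CARD('m) * CARD('n) - CARD('p)) f"
  obtains l x y where "l \<noteq> 0" "contract T l = outer x y"
proof -
  define S where "S = range (contract T)"
  let ?r = "CARD('m) * CARD('n) - CARD('p)"
  have S: "subspace S" unfolding S_def by (intro linear_subspace_image linear_contract subspace_UNIV)
  have "inj (contract T)"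
    using T linear_injective_0[OF linear_contract] by (auto simp: independent_slices_def)
  then have "dim S = CARD('p)"
    unfolding S_def using dim_image_eq[OF linear_contract, of T UNIV] by (simp add: dim_UNIV)
  moreover have "dim {M \<in> UNIV. \<forall>a\<in>S. orthogonal a M} + dim S = DIM(real ^ 'n ^ 'm)"
    using dim_subspace_orthogonal_to_vectors[OF S subspace_UNIV] by (simp add: dim_UNIV)
  ultimately have dim: "dim (S\<^sup>\<bottom>) = ?r" by (simp add: orthogonal_comp_def)
  obtain B where B: "B \<subseteq> S\<^sup>\<bottom>" "independent B" "S\<^sup>\<bottom> \<subseteq> span B" "card B = dim (S\<^sup>\<bottom>)"
    by (rule basis_exists[of "S\<^sup>\<bottom>"])
  obtain A where A: "bij_betw A {..<?r} B"
    using ex_bij_betw_nat_finite[OF independent_imp_finite[OF B(2)]] B(4) dim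
    by (auto simp: atLeast0LessThan)
  define f where "f x y i = (if i < ?r then A i \<bullet> outer x y else 0)"
    for x :: "real ^ 'm" and y :: "real ^ 'n" and i
  have "bilinear (\<lambda>x y. f x y i)" for i
    unfolding f_def bilinear_def
    by (auto intro!: linearI simp: outer_add_left outer_add_right outer_scaleR_left outer_scaleR_right inner_add_right)
  moreover have "f x y \<in> topspace (Euclidean_space ?r)" for x y
    by (simp add: f_def topspace_Euclidean_space)
  ultimately obtain x y where xy: "f x y = (\<lambda>_. 0)" "x \<noteq> 0" "y \<noteq> 0"
    using no unfolding nonsingular_bilinear_map_def by blast
  have orth: "v \<bullet> outer x y = 0" if "v \<in> B" for v
  proof -
    have "v \<in> A ` {..<?r}" using that unfolding bij_betw_imp_surj_on[OF A] .
    then obtain i where "i < ?r" "v = A i" by auto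
    then show ?thesis using fun_cong[OF xy(1), of i] by (simp add: f_def)
  qed
  have "orthogonal (outer x y) v" if "v \<in> S\<^sup>\<bottom>" for v
    using orthogonal_to_span[of v B "outer x y"] B(3) that orth by (auto simp: orthogonal_def inner_commute)
  then have "outer x y \<in> S\<^sup>\<bottom>\<^sup>\<bottom>"
    unfolding orthogonal_comp_def[of "S\<^sup>\<bottom>"] by (auto simp: orthogonal_commute)
  then have "outer x y \<in> S" using orthogonal_comp_self[OF S] by simp
  then obtain l where l: "contract T l = outer x y" unfolding S_def by (metis imageE)
  have "outer x y \<noteq> 0" using xy by (simp add: outer_eq_0_iff)
  then have "l \<noteq> 0" using l linear_0[OF linear_contract, of T] by metis
  then show ?thesis using that l by blast
qed

text \<open>A typical rank \<open>r \<noteq> p\<close> exceeds \<open>p\<close>. Without a nonsingular bilinear map, some tensor in the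
corresponding open set has a rank-one matrix in the span of its slices; exchanging the remaining spanning
matrices one at a time by \<open>rank_one_exchange\<close> leads to a tensor in the same open set of rank at most \<open>p\<close>.\<close>

lemma plural_typical_ranks_imp_nonsingular:
  assumes p: "(CARD('m) - 1) * (CARD('n) - 1) + 2 \<le> CARD('p)" "CARD('p) \<le> CARD('m) * CARD('n)"
    and plural: "plural_typical_ranks TYPE(real ^ 'p ^ 'n ^ 'm)"
  shows "\<exists>f :: real ^ 'm \<Rightarrow> real ^ 'n \<Rightarrow> nat \<Rightarrow> real.
    nonsingular_bilinear_map (CARD('m) * CARD('n) - CARD('p)) f"
proof (rule ccontr)
  assume no: "\<not> ?thesis"
  obtain r where r: "r \<noteq> CARD('p)" "typical_rank TYPE(real ^ 'p ^ 'n ^ 'm) r"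
    using plural unfolding plural_typical_ranks_def by metis
  then obtain U :: "(real ^ 'p ^ 'n ^ 'm) set" where
    U: "open U" "U \<noteq> {}" "\<And>T. T \<in> U \<Longrightarrow> tensor_rank T = r"
    unfolding typical_rank_def by blast
  obtain T where T: "T \<in> U" "independent_slices T"
    using U(1,2) independent_slices_dense[OF p(2)] by blast
  have "CARD('p) < r"
    using independent_slices_rank_ge[OF T(2) sum_of_rank_ones_tensor_rank] U(3)[OF T(1)] r(1) by simp
  obtain l x y where l: "l \<noteq> 0" "contract T l = outer x y"
    using independent_slices_meets_rank_one_cone[OF T(2) no] by blast
  then obtain k0 where k0: "l $ k0 \<noteq> 0" by (auto simp: vec_eq_iff)
  \<comment> \<open>\<open>P I\<close>: some tensor in \<open>U\<close> has its slices in the span of \<open>p\<close> matrices, those indexed by \<open>I\<close> being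
    of the form \<open>x \<otimes> y\<close>.\<close>
  define P where "P I \<longleftrightarrow> (\<exists>(a :: (real ^ 'm) ^ 'p) (b :: (real ^ 'n) ^ 'p) w c.
    (\<Sum>j\<in>UNIV. matrix_tensor (if j \<in> I then outer (a $ j) (b $ j) else w $ j) (c j)) \<in> U)" for I
  \<comment> \<open>Some slice occurs with a nonzero coefficient in \<open>x \<otimes> y\<close> and can be replaced by it.\<close>
  have "P {k0}"
  proof -
    let ?w = "\<lambda>k. contract T (axis k 1)"
    have "l = (\<Sum>k\<in>UNIV. l $ k *\<^sub>R axis k 1)"
      using basis_expansion[of l] by (simp add: scalar_mult_eq_scaleR)
    then have "outer x y = (\<Sum>k\<in>UNIV. l $ k *\<^sub>R ?w k)"
      by (metis (no_types, lifting) l(2) linear_contract linear_scale linear_sum sum.cong)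
    also have "\<dots> = l $ k0 *\<^sub>R ?w k0 + (\<Sum>k\<in>UNIV - {k0}. l $ k *\<^sub>R ?w k)"
      by (simp add: sum.remove)
    finally have "(1 / l $ k0) *\<^sub>R outer x y
        = ?w k0 + (\<Sum>k\<in>UNIV - {k0}. (l $ k / l $ k0) *\<^sub>R ?w k)"
      using k0 by (simp add: scaleR_add_right scaleR_sum_right)
    then have w: "?w k0 = (1 / l $ k0) *\<^sub>R outer x y + (\<Sum>k\<in>UNIV - {k0}. (- (l $ k / l $ k0)) *\<^sub>R ?w k)"
      by (simp add: sum_negf)
    have "T $ i $ j = (\<Sum>k\<in>UNIV. matrix_tensor (?w k) (axis k 1)) $ i $ j" for i j
      using basis_expansion[of "T $ i $ j"] by (simp add: scalar_mult_eq_scaleR inner_axis)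
    then have "T $ i = (\<Sum>k\<in>UNIV. matrix_tensor (?w k) (axis k 1)) $ i" for i
      by (intro vec_eq_iff[THEN iffD2, of "T $ i"] allI)
    then have "T = (\<Sum>k\<in>UNIV. matrix_tensor (?w k) (axis k 1))"
      by (intro vec_eq_iff[THEN iffD2, of T] allI)
    also note matrix_tensor_sum_exchange[OF w]
    also have "?w(k0 := outer x y) = (\<lambda>j. if j \<in> {k0} then outer ((\<chi> _. x) $ j) ((\<chi> _. y) $ j) else (\<chi> k. ?w k) $ j)"
      by (auto simp: fun_eq_iff)
    finally show ?thesis unfolding P_def using T(1) by (intro exI) (rule subst[of _ _ "\<lambda>X. X \<in> U"])
  qed
  have "P (insert k0 I)" if "finite I" for I
    using that
  proof (induction I)
    case empty
    then show ?case using \<open>P {k0}\<close> by simp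
  next
    case (insert k I)
    show ?case
    proof (cases "k \<in> insert k0 I")
      case True
      then have "insert k0 (insert k I) = insert k0 I" by auto
      then show ?thesis using insert.IH by simp
    next
      case False
      obtain a :: "(real ^ 'm) ^ 'p" and b :: "(real ^ 'n) ^ 'p" and w c where
        "(\<Sum>j\<in>UNIV. matrix_tensor (if j \<in> insert k0 I then outer (a $ j) (b $ j) else w $ j) (c j)) \<in> U"
        using insert.IH unfolding P_def by blast
      from rank_one_exchange[OF p(1) U(1) this insertI1 False] have "P (insert k (insert k0 I))"
        unfolding P_def .
      then show ?thesis by (simp add: insert_commute)
    qed
  qed
  from this[of UNIV] have "P UNIV" by simp
  then obtain a :: "(real ^ 'm) ^ 'p" and b :: "(real ^ 'n) ^ 'p" and w c where
    "(\<Sum>j\<in>UNIV. matrix_tensor (if j \<in> UNIV then outer (a $ j) (b $ j) else w $ j) (c j)) \<in> U"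
    unfolding P_def by blast
  moreover define c' where "c' = (\<chi> j. c j)"
  moreover define T' where "T' = (\<Sum>j\<in>UNIV. tensor3 (a $ j) (b $ j) (c' $ j))"
  ultimately have "T' \<in> U" by (simp add: matrix_tensor_outer)
  moreover have "sum_of_rank_ones CARD('p) T'"
    unfolding sum_of_rank_ones_card T'_def by (intro exI) (rule refl)
  ultimately have "r \<le> CARD('p)"
    using U(3)[of T'] unfolding tensor_rank_le_iff[symmetric] by simp
  then show False using \<open>CARD('p) < r\<close> by simp
qed

theorem theorem1p1:
  assumes "CARD('m::finite) \<ge> 3" and "CARD('n::finite) \<ge> 3"
    and "(CARD('m) - 1) * (CARD('n) - 1) + 1 \<le> CARD('p::finite)"
    and "CARD('p) \<le> CARD('m) * CARD('n)"
  shows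
    "((\<exists>f :: real ^ 'm \<Rightarrow> real ^ 'n \<Rightarrow> nat \<Rightarrow> real.
          nonsingular_bilinear_map (CARD('m) * CARD('n) - CARD('p)) f) \<longrightarrow>
        plural_typical_ranks TYPE(real ^ 'p ^ 'n ^ 'm)) \<and>
     (CARD('p) \<ge> (CARD('m) - 1) * (CARD('n) - 1) + 2 \<and>
        plural_typical_ranks TYPE(real ^ 'p ^ 'n ^ 'm) \<longrightarrow>
      (\<exists>f :: real ^ 'm \<Rightarrow> real ^ 'n \<Rightarrow> nat \<Rightarrow> real.
          nonsingular_bilinear_map (CARD('m) * CARD('n) - CARD('p)) f))"
  using nonsingular_imp_plural_typical_ranks[OF assms(3,4)]
    plural_typical_ranks_imp_nonsingular[OF _ assms(4)] by blast

end
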